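(* Let $\mathcal{B}$ be a uniformly convex Banach space with modulus of uniform convexity $u$. Fix $\varepsilon>0$ and $x\in\mathcal{B}$ with $x\ne0$. Pick some $\eta>0$ such that $\eta<\frac12u(\varepsilon)$ if $\Vert x\Vert\le1$, or $\eta<\frac12u(\varepsilon/\Vert x\Vert)$ if $\Vert x\Vert>1$. Let $G$ be a locally compact second countable amenable group that acts Borel strongly on $\mathcal{B}$ via the representation $\pi:G\to\mathcal{L}_1(\mathcal{B},\mathcal{B})$, with Følner sequence $(F_n)$, and let $\lambda\in\mathbb{N}$. (a) If $\Vert x\Vert\le1$ and $(F_n)$ is $\left(\lambda,\frac{\eta}{3\Vert x\Vert}\right)$-fast, then the sequence $(A_nx)$ has at most $\lambda\cdot\left\lfloor\frac{\Vert x\Vert}{\frac12u(\varepsilon)-\eta}\right\rfloor+\lambda$ $\varepsilon$-fluctuations. (b) If $\Vert x\Vert>1$ and $(F_n)$ is $\left(\lambda,\frac{\eta}{3}\right)$-fast, then the sequence $(A_nx)$ has at most $\lambda\cdot\left\lfloor\frac{1}{\frac12u(\varepsilon/\Vert x\Vert)-\eta}\right\rfloor+\lambda$ $\varepsilon$-fluctuations.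
   Context: Modulus of uniform convexity: a normed space $(\mathcal{B},\Vert\cdot\Vert)$ is uniformly convex if there is a nondecreasing function $u$, with $u(\varepsilon)>0$ for $\varepsilon>0$, such that for all $x,y\in\mathcal{B}$ with $\Vert x\Vert\le\Vert y\Vert\le1$ and $\Vert x-y\Vert\ge\varepsilon$ one has $\Vert\frac12(x+y)\Vert\le\Vert y\Vert-u(\varepsilon)$; such $u$ is called a modulus of uniform convexity. Actions: $G$ carries left Haar measure, denoted $|\cdot|$ or $dg$, on a $\sigma$-algebra containing the Borel sets. $\mathcal{L}_1(\mathcal{B},\mathcal{B})$ is the set of linear operators on $\mathcal{B}$ of operator norm $1$. $G$ acts Borel strongly on $\mathcal{B}$ via $\pi:G\to\mathcal{L}_1(\mathcal{B},\mathcal{B})$ if $\pi(e)=\mathrm{id}$, $\pi(g)\pi(h)=\pi(gh)$, each $\pi(g)\in\mathcal{L}_1(\mathcal{B},\mathcal{B})$, and for every $x\in\mathcal{B}$ the map $f(g)=\pi(g)x$ is strongly Borel, i.e. $b^*\circ f$ is Borel for all $b^*\in\mathcal{B}^*$ and $f(G)$ is separable. Følner sequences: a sequence $(F_n)$ of compact subsets of $G$ (with $|F_n|>0$) is a Følner sequence if for every $\varepsilon>0$ and compact $K\subset G$ there is $N$ such that for all $n\ge N$ there is a (measurable) $K'\subset K$ with $|K\setminus K'|<|K|\varepsilon$ and $|F_n\Delta kF_n|<|F_n|\varepsilon$ for all $k\in K'$. If $G$ is countable discrete, with counting measure: for every $\varepsilon>0$ and finite $K\subset G$ there is $N$ such that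 $|F_n\Delta kF_n|<|F_n|\varepsilon$ for all $n\ge N$, $k\in K$. Fast Følner sequences: for $\lambda\in\mathbb{N}$, $\varepsilon>0$, $(F_n)$ is $(\lambda,\varepsilon)$-fast if: for $G$ countable discrete, for all $n\in\mathbb{N}$, all $m\ge n+\lambda$ and all $g\in F_n$, $|F_m\Delta gF_m|/|F_m|<\varepsilon$; for $G$ locally compact second countable, for all $n\in\mathbb{N}$ and all $m\ge n+\lambda$ there is a (measurable) set $F_n'\subset F_n$ with $|F_n\setminus F_n'|<|F_n|\varepsilon$ such that $|F_m\Delta gF_m|/|F_m|<\varepsilon$ for all $g\in F_n'$. Ergodic averages: $A_nx:=\frac{1}{|F_n|}\int_{F_n}\pi(g^{-1})x\,dg$ (Bochner integral). Fluctuations: a sequence $(x_n)$ in a metric space has at most $N$ $\varepsilon$-fluctuations if for every finite sequence $n_1<\dots<n_k$ with $d(x_{n_i},x_{n_{i+1}})\ge\varepsilon$ for all $1\le i<k$, one has $k-1\le N$.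
   Formalization: Here λ is taken to be at least 1; for λ = 0 the claim fails (Z/2 acting on the reals by sign, F_0 trivial, F_n = G for n ≥ 1, gives one fluctuation against a bound of 0). The Følner condition is required only for compact K of positive measure. *)

theory Defs
  imports "HOL-Analysis.Analysis"
begin

text \<open>Only the values of the modulus on positive reals carry information.\<close>

definition uniform_convexity_modulus :: "'b::real_normed_vector itself \<Rightarrow> (real \<Rightarrow> real) \<Rightarrow> bool"
  where "uniform_convexity_modulus _ u \<longleftrightarrow>
    mono_on {0<..} u \<and> (\<forall>\<epsilon>>0. 0 < u \<epsilon>) \<and>
    (\<forall>\<epsilon>>0. \<forall>x y :: 'b. norm x \<le> norm y \<longrightarrow> norm y \<le> 1 \<longrightarrow> \<epsilon> \<le> norm (x - y) \<longrightarrow>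
       norm ((1/2) *\<^sub>R (x + y)) \<le> norm y - u \<epsilon>)"

text \<open>
  The library's \<^const>\<open>has_bochner_integral\<close> requires a second countable, i.e. separable,
  target space. Here the target is an arbitrary normed space, and Borel measurability is replaced
  by strong measurability, i.e. approximability by simple functions. The lemma
  \<open>has_strong_integral_iff_has_bochner_integral\<close> below shows that both notions agree
  when both make sense.
\<close>

definition strongly_measurable :: "'a measure \<Rightarrow> ('a \<Rightarrow> 'b::real_normed_vector) \<Rightarrow> bool"
  where "strongly_measurable M f \<longleftrightarrow>
    (\<exists>s. (\<forall>i. simple_function M (s i)) \<and> (\<forall>x\<in>space M. (\<lambda>i::nat. s i x) \<longlonglongrightarrow> f x))"

definition has_strong_integral :: "'a measure \<Rightarrow> ('a \<Rightarrow> 'b::real_normed_vector) \<Rightarrow> 'b \<Rightarrow> bool"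
  where "has_strong_integral M f I \<longleftrightarrow>
    strongly_measurable M f \<and>
    (\<exists>s. (\<forall>i. Bochner_Integration.simple_bochner_integrable M (s i)) \<and>
         (\<lambda>i::nat. \<integral>\<^sup>+x. norm (f x - s i x) \<partial>M) \<longlonglongrightarrow> 0 \<and>
         (\<lambda>i. Bochner_Integration.simple_bochner_integral M (s i)) \<longlonglongrightarrow> I)"

definition strong_integral :: "'a measure \<Rightarrow> ('a \<Rightarrow> 'b::real_normed_vector) \<Rightarrow> 'b"
  where "strong_integral M f =
    (if \<exists>I. has_strong_integral M f I then THE I. has_strong_integral M f I else 0)"

lemma strongly_measurable_iff_borel_measurable:
  fixes f :: "'a \<Rightarrow> 'b::{real_normed_vector, second_countable_topology}"
  shows "strongly_measurable M f \<longleftrightarrow> f \<in> borel_measurable M"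
proof
  assume "strongly_measurable M f"
  then obtain s where s: "\<And>i. simple_function M (s i)"
    "\<And>x. x \<in> space M \<Longrightarrow> (\<lambda>i::nat. s i x) \<longlonglongrightarrow> f x"
    unfolding strongly_measurable_def by blast
  show "f \<in> borel_measurable M"
    by (rule borel_measurable_LIMSEQ_metric[of s])
       (use s in \<open>auto intro: borel_measurable_simple_function\<close>)
next
  assume "f \<in> borel_measurable M"
  from borel_measurable_implies_sequence_metric[OF this, of 0]
  show "strongly_measurable M f"
    unfolding strongly_measurable_def by blast
qed

lemma has_strong_integral_iff_has_bochner_integral:
  fixes f :: "'a \<Rightarrow> 'b::{real_normed_vector, second_countable_topology}"
  shows "has_strong_integral M f I \<longleftrightarrow> has_bochner_integral M f I"
  unfolding has_strong_integral_def has_bochner_integral.simps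
    strongly_measurable_iff_borel_measurable by blast

text \<open>
  Groups are written additively, but \<^class>\<open>topological_group_add\<close> does not assume
  commutativity: the translate of \<open>A\<close> by \<open>g\<close> from the left is \<open>(+) g ` A\<close>,
  and \<open>- g\<close> is the inverse of \<open>g\<close>.
\<close>

definition left_haar_measure :: "'g::{topological_group_add, t2_space} measure \<Rightarrow> bool"
  where "left_haar_measure M \<longleftrightarrow>
    space M = UNIV \<and> sets borel \<subseteq> sets M \<and>
    emeasure M UNIV \<noteq> 0 \<and>
    (\<forall>K. compact K \<longrightarrow> emeasure M K < \<infinity>) \<and>
    (\<forall>A\<in>sets M. emeasure M A = (INF U\<in>{U. open U \<and> A \<subseteq> U}. emeasure M U)) \<and>
    (\<forall>U. open U \<longrightarrow> emeasure M U = (SUP K\<in>{K. compact K \<and> K \<subseteq> U}. emeasure M K)) \<and>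
    (\<forall>g. \<forall>A\<in>sets M. (+) g ` A \<in> sets M \<and> emeasure M ((+) g ` A) = emeasure M A)"

text \<open>
  The condition is only imposed for \<open>K\<close> of positive measure, since no set satisfies the strict
  inequality \<open>measure M (K - K') < \<epsilon> * measure M K\<close> if \<open>K\<close> is null (e.g. empty).
\<close>

definition folner_sequence ::
    "'g::{topological_group_add, t2_space} measure \<Rightarrow> (nat \<Rightarrow> 'g set) \<Rightarrow> bool"
  where "folner_sequence M F \<longleftrightarrow>
    (\<forall>n. compact (F n) \<and> 0 < measure M (F n)) \<and>
    (\<forall>\<epsilon>>0. \<forall>K. compact K \<longrightarrow> 0 < measure M K \<longrightarrow>
       (\<exists>N. \<forall>n\<ge>N. \<exists>K'\<in>sets M. K' \<subseteq> K \<and> measure M (K - K') < measure M K * \<epsilon> \<and>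
          (\<forall>k\<in>K'. measure M (sym_diff (F n) ((+) k ` F n)) < measure M (F n) * \<epsilon>)))"

definition amenable_group :: "'g::{topological_group_add, t2_space} itself \<Rightarrow> bool"
  where "amenable_group _ \<longleftrightarrow>
    (\<exists>(M :: 'g measure) F. left_haar_measure M \<and> folner_sequence M F)"

definition fast_sequence ::
    "'g::{topological_group_add, t2_space} measure \<Rightarrow> (nat \<Rightarrow> 'g set) \<Rightarrow> nat \<Rightarrow> real \<Rightarrow> bool"
  where "fast_sequence M F l \<epsilon> \<longleftrightarrow>
    (\<forall>n. \<forall>m\<ge>n + l. \<exists>F'\<in>sets M. F' \<subseteq> F n \<and> measure M (F n - F') < measure M (F n) * \<epsilon> \<and>
       (\<forall>g\<in>F'. measure M (sym_diff (F m) ((+) g ` F m)) / measure M (F m) < \<epsilon>))"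

text \<open>
  The conditions customary for countable discrete groups, without exceptional sets, imply
  those above.
\<close>

lemma folner_sequenceI_all:
  fixes M :: "'g::{topological_group_add, t2_space} measure"
  assumes "left_haar_measure M" "\<And>n. compact (F n)" "\<And>n. 0 < measure M (F n)"
    and "\<And>\<epsilon> K. 0 < \<epsilon> \<Longrightarrow> compact K \<Longrightarrow>
      \<exists>N. \<forall>n\<ge>N. \<forall>k\<in>K. measure M (sym_diff (F n) ((+) k ` F n)) < measure M (F n) * \<epsilon>"
  shows "folner_sequence M F"
proof -
  have "K \<in> sets M" if "compact K" for K
    using that assms(1) borel_compact[of K] by (auto simp: left_haar_measure_def)
  then have "\<exists>N. \<forall>n\<ge>N. \<exists>K'\<in>sets M. K' \<subseteq> K \<and> measure M (K - K') < measure M K * \<epsilon> \<and>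
      (\<forall>k\<in>K'. measure M (sym_diff (F n) ((+) k ` F n)) < measure M (F n) * \<epsilon>)"
    if "0 < \<epsilon>" "compact K" "0 < measure M K" for \<epsilon> :: real and K
    using assms(4)[OF that(1,2)] that by (metis Diff_cancel measure_empty mult_pos_pos subset_refl)
  with assms(2,3) show ?thesis
    unfolding folner_sequence_def by blast
qed

lemma fast_sequenceI_all:
  fixes M :: "'g::{topological_group_add, t2_space} measure"
  assumes "left_haar_measure M" "folner_sequence M F" "0 < \<epsilon>"
    and "\<And>n m g. m \<ge> n + l \<Longrightarrow> g \<in> F n \<Longrightarrow>
      measure M (sym_diff (F m) ((+) g ` F m)) / measure M (F m) < \<epsilon>"
  shows "fast_sequence M F l \<epsilon>"
proof -
  have F: "F n \<in> sets M" "0 < measure M (F n)" for n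
    using assms(1,2) borel_compact[of "F n"]
    by (auto simp: left_haar_measure_def folner_sequence_def)
  show ?thesis
    unfolding fast_sequence_def
  proof (intro allI impI)
    fix n m assume "n + l \<le> m"
    then show "\<exists>F'\<in>sets M. F' \<subseteq> F n \<and> measure M (F n - F') < measure M (F n) * \<epsilon> \<and>
        (\<forall>g\<in>F'. measure M (sym_diff (F m) ((+) g ` F m)) / measure M (F m) < \<epsilon>)"
      using F[of n] assms(3,4) by (intro bexI[of _ "F n"]) auto
  qed
qed

definition acts_borel_strongly ::
    "('g::topological_group_add \<Rightarrow> 'b::real_normed_vector \<Rightarrow>\<^sub>L 'b) \<Rightarrow> bool"
  where "acts_borel_strongly \<pi> \<longleftrightarrow>
    \<pi> 0 = id_blinfun \<and>
    (\<forall>g h. \<pi> (g + h) = \<pi> g o\<^sub>L \<pi> h) \<and>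
    (\<forall>g. norm (\<pi> g) = 1) \<and>
    (\<forall>x. (\<forall>b :: 'b \<Rightarrow>\<^sub>L real. (\<lambda>g. blinfun_apply b (\<pi> g x)) \<in> borel_measurable borel) \<and>
         separable_space (top_of_set (range (\<lambda>g. \<pi> g x))))"

definition ergodic_average ::
    "'g measure \<Rightarrow> (nat \<Rightarrow> 'g set) \<Rightarrow> ('g::topological_group_add \<Rightarrow> 'b::real_normed_vector \<Rightarrow>\<^sub>L 'b)
      \<Rightarrow> 'b \<Rightarrow> nat \<Rightarrow> 'b"
  where "ergodic_average M F \<pi> x n =
    (1 / measure M (F n)) *\<^sub>R strong_integral M (\<lambda>g. indicator (F n) g *\<^sub>R \<pi> (- g) x)"

definition at_most_fluctuations :: "nat \<Rightarrow> real \<Rightarrow> (nat \<Rightarrow> 'a::metric_space) \<Rightarrow> bool"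
  where "at_most_fluctuations N \<epsilon> s \<longleftrightarrow>
    (\<forall>ns. sorted_wrt (<) ns \<longrightarrow>
       (\<forall>i. Suc i < length ns \<longrightarrow> \<epsilon> \<le> dist (s (ns ! i)) (s (ns ! Suc i))) \<longrightarrow>
       length ns - 1 \<le> N)"

end

theory Submission
  imports Defs
begin

text \<open>
  Write \<open>A\<^sub>n x\<close> for the averages. By Fubini and left invariance, fastness makes
  \<open>A\<^sub>m A\<^sub>n x\<close> and \<open>A\<^sub>m x\<close> differ by at most \<open>\<eta>\<close> when \<open>m \<ge> n + l\<close>, and \<open>A\<^sub>m\<close> is a contraction.
  So if \<open>A\<^sub>k x\<close> and \<open>A\<^sub>n x\<close> are at distance at least \<open>\<epsilon>\<close>, every \<open>A\<^sub>m x\<close> with \<open>m\<close> late enough has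
  norm at most that of the midpoint of \<open>A\<^sub>k x\<close> and \<open>A\<^sub>n x\<close> plus \<open>\<eta>\<close>, which uniform convexity
  puts below \<open>max (norm (A\<^sub>k x)) (norm (A\<^sub>n x)) - u \<epsilon> + \<eta>\<close>. Norms being nonnegative, this drop can
  happen only a bounded number of times. Identities and estimates for vector-valued integrals are
  checked on norming functionals, which a Hahn--Banach argument supplies; Pettis' theorem gives
  the existence of the integrals, since orbits are separable.
\<close>

section \<open>Norming functionals\<close>

definition sublinear :: "('a::real_vector \<Rightarrow> real) \<Rightarrow> bool"
  where "sublinear p \<longleftrightarrow>
    (\<forall>x y. p (x + y) \<le> p x + p y) \<and> (\<forall>c\<ge>0. \<forall>x. p (c *\<^sub>R x) = c * p x)"

lemma sublinearD:
  assumes "sublinear p"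
  shows "p (x + y) \<le> p x + p y" "c \<ge> 0 \<Longrightarrow> p (c *\<^sub>R x) = c * p x" "p 0 = 0" "- p (- x) \<le> p x"
proof -
  show *: "p (x + y) \<le> p x + p y" "c \<ge> 0 \<Longrightarrow> p (c *\<^sub>R x) = c * p x" for x y c
    using assms by (auto simp: sublinear_def)
  show "p 0 = 0"
    using *(2)[of 0 0] by simp
  then show "- p (- x) \<le> p x"
    using *(1)[of x "- x"] by simp
qed

text \<open>One inequality in the homogeneity suffices: applied with \<open>inverse c\<close> at
  \<open>c *\<^sub>R x\<close> it gives the reverse one.\<close>

lemma sublinearI:
  assumes "\<And>x y. p (x + y) \<le> p x + p y" "p 0 = 0"
    and le: "\<And>c x. c > 0 \<Longrightarrow> p (c *\<^sub>R x) \<le> c * p x"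
  shows "sublinear p"
proof -
  have "p (c *\<^sub>R x) = c * p x" if "c \<ge> 0" for c x
  proof (cases "c = 0")
    case False
    with that have "c > 0" by simp
    then have "p x \<le> inverse c * p (c *\<^sub>R x)"
      using le[of "inverse c" "c *\<^sub>R x"] by simp
    with \<open>c > 0\<close> have "c * p x \<le> p (c *\<^sub>R x)"
      by (simp add: field_simps)
    with le[OF \<open>c > 0\<close>] show ?thesis
      by (meson order_antisym)
  qed (simp add: assms)
  with assms show ?thesis
    by (simp add: sublinear_def)
qed

text \<open>Take for \<open>q\<close> the infimum over \<open>t \<ge> 0\<close> of
  \<open>p (x + t *\<^sub>R y) - t * p y\<close>. The value \<open>t = 0\<close> gives
  \<open>q \<le> p\<close>, and \<open>t = 1\<close> at \<open>x = - y\<close> gives the bound at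
  \<open>- y\<close>. The lemma has two uses: it forces minimal sublinear functionals to be odd, and
  it prepares the norm so that a linear functional below it attains the norm at a given
  vector.\<close>

lemma sublinear_decrease:
  assumes p: "sublinear p"
  obtains q where "sublinear q" "q \<le> p" "q (- y) \<le> - p y"
proof
  let ?f = "\<lambda>x t. p (x + t *\<^sub>R y) - t * p y"
  let ?q = "\<lambda>x. INF t\<in>{0..}. ?f x t"
  have bdd: "bdd_below (?f x ` {0..})" for x
  proof (rule bdd_belowI2)
    fix t :: real assume "t \<in> {0..}"
    then have "t * p y = p (t *\<^sub>R y)" by (simp add: sublinearD(2)[OF p])
    also have "\<dots> \<le> p (x + t *\<^sub>R y) + p (- x)"
      using sublinearD(1)[OF p, of "x + t *\<^sub>R y" "- x"] by simp
    finally show "- p (- x) \<le> ?f x t" by simp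
  qed
  have le: "?q x \<le> ?f x t" if "t \<ge> 0" for x t
    using cINF_lower[OF bdd] that by (metis atLeast_iff)
  have ge: "a \<le> ?q x" if "\<And>t. t \<ge> 0 \<Longrightarrow> a \<le> ?f x t" for a x
    by (rule cINF_greatest) (use that in auto)
  show "sublinear ?q"
  proof (rule sublinearI)
    fix x x'
    have "?q (x + x') - ?f x' t' \<le> ?f x t" if "t \<ge> 0" "t' \<ge> 0" for t t'
    proof -
      have "?q (x + x') \<le> ?f (x + x') (t + t')"
        using that by (intro le) simp
      moreover have "p ((x + t *\<^sub>R y) + (x' + t' *\<^sub>R y)) \<le> p (x + t *\<^sub>R y) + p (x' + t' *\<^sub>R y)"
        by (rule sublinearD(1)[OF p])
      ultimately show ?thesis
        by (simp add: algebra_simps)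
    qed
    then have "?q (x + x') - ?f x' t' \<le> ?q x" if "t' \<ge> 0" for t'
      using that by (intro ge)
    then have "?q (x + x') - ?q x \<le> ?f x' t'" if "t' \<ge> 0" for t'
      using that by (simp add: algebra_simps)
    then have "?q (x + x') - ?q x \<le> ?q x'"
      by (intro ge)
    then show "?q (x + x') \<le> ?q x + ?q x'" by simp
  next
    have "?f 0 t = 0" if "t \<ge> 0" for t
      using that by (simp add: sublinearD(2)[OF p])
    then have "?f 0 ` {0..} = {0}" by (auto simp: image_iff intro: exI[of _ 0])
    then show "?q 0 = 0" by simp
  next
    fix c :: real and x assume "c > 0"
    have "inverse c * ?q (c *\<^sub>R x) \<le> ?f x t" if "t \<ge> 0" for t
    proof -
      have "?q (c *\<^sub>R x) \<le> ?f (c *\<^sub>R x) (c * t)"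
        using that \<open>c > 0\<close> by (intro le) simp
      also have "\<dots> = c * ?f x t"
        using sublinearD(2)[OF p, of c "x + t *\<^sub>R y"] \<open>c > 0\<close> by (simp add: algebra_simps)
      finally show ?thesis
        using \<open>c > 0\<close> by (simp add: field_simps)
    qed
    then have "inverse c * ?q (c *\<^sub>R x) \<le> ?q x" by (rule ge)
    then show "?q (c *\<^sub>R x) \<le> c * ?q x"
      using \<open>c > 0\<close> by (simp add: field_simps)
  qed
  show "?q \<le> p"
  proof (rule le_funI)
    show "?q x \<le> p x" for x
      using le[of 0 x] by simp
  qed
  show "?q (- y) \<le> - p y"
    using le[of 1 "- y"] by (simp add: sublinearD(3)[OF p])
qed

lemma minimal_sublinear_below:
  assumes p: "sublinear p"
  obtains q where "sublinear q" "q \<le> p" "\<And>r. sublinear r \<Longrightarrow> r \<le> q \<Longrightarrow> r = q"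
proof -
  \<comment> \<open>The order is reversed, so that the maximal element provided by Zorn's lemma is
    minimal pointwise. The bound of a nonempty chain is its pointwise infimum.\<close>
  let ?A = "{q. sublinear q \<and> q \<le> p}" and ?P = "\<lambda>a b :: 'a \<Rightarrow> real. b \<le> a"
  have "\<exists>m\<in>?A. \<forall>a\<in>?A. ?P m a \<longrightarrow> a = m"
  proof (rule predicate_Zorn)
    show "partial_order_on ?A (relation_of ?P ?A)"
      by (rule partial_order_on_relation_ofI) auto
  next
    fix C assume "C \<in> Chains (relation_of ?P ?A)"
    then have C: "C \<subseteq> ?A" and chain: "\<And>q r. q \<in> C \<Longrightarrow> r \<in> C \<Longrightarrow> q \<le> r \<or> r \<le> q"
      unfolding Chains_def relation_of_def by auto
    show "\<exists>u\<in>?A. \<forall>a\<in>C. ?P a u"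
    proof (cases "C = {}")
      case True
      with p show ?thesis by auto
    next
      case False
      let ?u = "\<lambda>x. INF q\<in>C. q x"
      \<comment> \<open>This lower bound does not depend on \<open>q\<close>, so the infimum over
        the chain is a real number.\<close>
      have "- p (- x) \<le> q x" if "q \<in> C" for q x
      proof -
        have "sublinear q" "q (- x) \<le> p (- x)"
          using that C by (auto simp: le_fun_def)
        with sublinearD(4)[of q x] show ?thesis by linarith
      qed
      then have le: "?u x \<le> q x" if "q \<in> C" for q x
        using that by (intro cINF_lower bdd_belowI2)
      have ge: "a \<le> ?u x" if "\<And>q. q \<in> C \<Longrightarrow> a \<le> q x" for a x
        by (rule cINF_greatest) (use that False in auto)
      have "sublinear ?u"
      proof (rule sublinearI)
        fix x y
        have "?u (x + y) \<le> q x + r y" if qr: "q \<in> C" "r \<in> C" for q r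
        proof -
          \<comment> \<open>Subadditivity of the infimum needs one functional below both
            \<open>q\<close> and \<open>r\<close>; in a chain the smaller of the two will
            do.\<close>
          obtain s where s: "s \<in> C" "s \<le> q" "s \<le> r"
            using chain[OF qr] qr by auto
          then have "?u (x + y) \<le> s (x + y)" by (intro le)
          also have "\<dots> \<le> s x + s y"
            using s C by (intro sublinearD(1)) auto
          also have "\<dots> \<le> q x + r y"
            using s by (intro add_mono) (auto simp: le_fun_def)
          finally show ?thesis .
        qed
        then have "?u (x + y) - r y \<le> ?u x" if "r \<in> C" for r
          using that by (intro ge) (simp add: algebra_simps)
        then have "?u (x + y) - ?u x \<le> ?u y"
          by (intro ge) (simp add: algebra_simps)
        then show "?u (x + y) \<le> ?u x + ?u y" by simp
      next
        have "q 0 = 0" if "q \<in> C" for q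
          using that C by (auto simp: sublinearD(3))
        then have "(\<lambda>q. q 0) ` C = (\<lambda>_. 0) ` C" by (rule image_cong[OF refl])
        then show "?u 0 = 0" using False by simp
      next
        fix c :: real and x assume c: "c > 0"
        have "inverse c * ?u (c *\<^sub>R x) \<le> q x" if "q \<in> C" for q
        proof -
          have "?u (c *\<^sub>R x) \<le> q (c *\<^sub>R x)" using that by (rule le)
          also have "\<dots> = c * q x"
            using that C c by (intro sublinearD(2)) auto
          finally show ?thesis using c by (simp add: field_simps)
        qed
        then have "inverse c * ?u (c *\<^sub>R x) \<le> ?u x" by (rule ge)
        then show "?u (c *\<^sub>R x) \<le> c * ?u x" using c by (simp add: field_simps)
      qed
      moreover obtain q where "q \<in> C" using False by auto
      moreover have "?u \<le> q" if "q \<in> C" for q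
        using le[OF that] by (rule le_funI)
      ultimately show ?thesis
        using C by (intro bexI[of _ ?u]) (blast intro: order_trans)+
    qed
  qed
  then obtain q where "q \<in> ?A" "\<forall>a\<in>?A. ?P q a \<longrightarrow> a = q" ..
  then show ?thesis
    by (intro that[of q]) (auto intro: order_trans)
qed

text \<open>Hahn--Banach: sublinear functionals that are minimal below a given one are linear.\<close>

lemma linear_below_sublinear:
  assumes "sublinear p"
  obtains f where "linear f" "f \<le> p"
proof -
  obtain q where q: "sublinear q" "q \<le> p" "\<And>r. sublinear r \<Longrightarrow> r \<le> q \<Longrightarrow> r = q"
    using minimal_sublinear_below[OF assms] by metis
  have minus: "q (- y) = - q y" for y
  proof (rule antisym)
    \<comment> \<open>The sublinear functional below \<open>q\<close> that
      \<open>sublinear_decrease\<close> yields is \<open>q\<close> itself by minimality. Together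
      with the converse inequality this makes \<open>q\<close> odd, and an odd sublinear functional
      is linear.\<close>
    show "q (- y) \<le> - q y"
      by (rule sublinear_decrease[OF q(1), of y]) (use q(3) in auto)
    show "- q y \<le> q (- y)"
      using sublinearD(4)[OF q(1), of y] by simp
  qed
  have "linear q"
  proof (rule linearI)
    fix x y
    show "q (x + y) = q x + q y"
      using sublinearD(1)[OF q(1), of "x + y" "- y"] sublinearD(1)[OF q(1), of x y]
      by (simp add: minus)
  next
    fix c :: real and x
    show "q (c *\<^sub>R x) = c *\<^sub>R q x"
      using sublinearD(2)[OF q(1), of c x] sublinearD(2)[OF q(1), of "- c" x] minus[of "c *\<^sub>R x"]
      by (cases "c \<ge> 0") auto
  qed
  with q(2) that show ?thesis by blast
qed

text \<open>The norm is first decreased to a sublinear \<open>q\<close> with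
  \<open>q (- x) \<le> - norm x\<close>. Every linear \<open>f\<close> below \<open>q\<close> then
  satisfies \<open>f x \<ge> norm x\<close>, while \<open>f \<le> norm\<close> gives the other
  inequality and the bound on the operator norm.\<close>

lemma norming_functional:
  fixes x :: "'b::real_normed_vector"
  obtains b :: "'b \<Rightarrow>\<^sub>L real" where "norm b \<le> 1" "b x = norm x"
proof -
  have "sublinear (norm :: 'b \<Rightarrow> real)"
    by (simp add: sublinear_def norm_triangle_ineq)
  then obtain q where q: "sublinear q" "q \<le> norm" "q (- x) \<le> - norm x"
    by (rule sublinear_decrease)
  obtain f where f: "linear f" "f \<le> q"
    using linear_below_sublinear[OF q(1)] .
  interpret f: linear f by fact
  have le: "f y \<le> norm y" for y
    using f(2) q(2) by (meson le_funE order_trans)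
  have abs: "norm (f y) \<le> norm y" for y
    using le[of y] le[of "- y"] by (simp add: f.neg abs_le_iff)
  then have bl: "bounded_linear f"
    using f.add f.scale by (intro bounded_linear_intro[where K = 1]) auto
  have "f (- x) \<le> - norm x"
    using f(2) q(3) by (meson le_funE order_trans)
  with le[of x] have "f x = norm x" by (simp add: f.neg)
  moreover have "norm (Blinfun f) \<le> 1"
    using abs by (intro norm_blinfun_bound) (auto simp: bounded_linear_Blinfun_apply[OF bl])
  ultimately show ?thesis
    using that bounded_linear_Blinfun_apply[OF bl] by metis
qed

section \<open>Strong integrals and functionals\<close>

text \<open>In a nonseparable space the difference of two Borel maps need not be Borel, so
  measurability is obtained as a limit from differences of simple functions.\<close>

lemma strongly_measurable_norm_diff:
  assumes f: "strongly_measurable M f" and s: "simple_function M s"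
  shows "(\<lambda>x. norm (f x - s x)) \<in> borel_measurable M"
proof -
  obtain t :: "nat \<Rightarrow> 'a \<Rightarrow> 'b" where t: "\<And>i. simple_function M (t i)"
    "\<And>x. x \<in> space M \<Longrightarrow> (\<lambda>i. t i x) \<longlonglongrightarrow> f x"
    using f unfolding strongly_measurable_def by blast
  show ?thesis
  proof (rule borel_measurable_LIMSEQ_metric)
    show "(\<lambda>x. norm (t i x - s x)) \<in> borel_measurable M" for i
      by (rule borel_measurable_simple_function) (rule simple_function_compose2[OF t(1) s])
    show "(\<lambda>i. norm (t i x - s x)) \<longlonglongrightarrow> norm (f x - s x)" if "x \<in> space M" for x
      using t(2)[OF that] by (intro tendsto_intros)
  qed
qed

text \<open>Composing the simple approximants of \<open>f\<close> with \<open>b\<close> yields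
  simple approximants of \<open>b\<close> after \<open>f\<close>, with errors enlarged by at most
  the factor \<open>norm b\<close>. This reduces statements on vector-valued integrals to scalar
  ones.\<close>

lemma has_strong_integral_blinfun:
  fixes b :: "'b::real_normed_vector \<Rightarrow>\<^sub>L 'c::{real_normed_vector, second_countable_topology}"
  assumes "has_strong_integral M f I"
  shows "has_bochner_integral M (\<lambda>x. b (f x)) (b I)"
proof -
  from assms obtain s where f: "strongly_measurable M f"
    and s: "\<And>i. Bochner_Integration.simple_bochner_integrable M (s i)"
    and lim: "(\<lambda>i::nat. \<integral>\<^sup>+x. norm (f x - s i x) \<partial>M) \<longlonglongrightarrow> 0"
    and int: "(\<lambda>i. Bochner_Integration.simple_bochner_integral M (s i)) \<longlonglongrightarrow> I"
    unfolding has_strong_integral_def by blast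
  have sf: "simple_function M (s i)" for i
    using s by (rule simple_bochner_integrable.cases)
  have [measurable]: "(\<lambda>x. norm (f x - s i x)) \<in> borel_measurable M" for i
    by (rule strongly_measurable_norm_diff[OF f sf])
  have "(\<lambda>x. blinfun_apply b (f x)) \<in> borel_measurable M"
  proof -
    obtain t :: "nat \<Rightarrow> 'a \<Rightarrow> 'b" where t: "\<And>i. simple_function M (t i)"
      "\<And>x. x \<in> space M \<Longrightarrow> (\<lambda>i. t i x) \<longlonglongrightarrow> f x"
      using f unfolding strongly_measurable_def by blast
    show ?thesis
    proof (rule borel_measurable_LIMSEQ_metric)
      show "(\<lambda>x. b (t i x)) \<in> borel_measurable M" for i
        by (rule borel_measurable_simple_function) (rule simple_function_compose1[OF t(1)])
      show "(\<lambda>i. b (t i x)) \<longlonglongrightarrow> b (f x)" if "x \<in> space M" for x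
        using t(2)[OF that] by (intro tendsto_intros)
    qed
  qed
  moreover have "Bochner_Integration.simple_bochner_integrable M (\<lambda>x. b (s i x))" for i
    using simple_bochner_integrable_compose2[of "\<lambda>x _. b x", OF _ s s] by simp
  moreover have "(\<lambda>i. \<integral>\<^sup>+x. norm (b (f x) - b (s i x)) \<partial>M) \<longlonglongrightarrow> 0"
  proof (rule tendsto_sandwich[where f = "\<lambda>_. 0"
        and h = "\<lambda>i. ennreal (norm b) * (\<integral>\<^sup>+x. norm (f x - s i x) \<partial>M)"])
    have "(\<integral>\<^sup>+x. norm (b (f x) - b (s i x)) \<partial>M)
        \<le> (\<integral>\<^sup>+x. ennreal (norm b) * ennreal (norm (f x - s i x)) \<partial>M)" for i
      by (intro nn_integral_mono)
        (metis blinfun.diff_right ennreal_leI ennreal_mult norm_blinfun norm_ge_zero)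
    also have "\<dots> i = ennreal (norm b) * (\<integral>\<^sup>+x. norm (f x - s i x) \<partial>M)" for i
      by (rule nn_integral_cmult) measurable
    finally show "\<forall>\<^sub>F i in sequentially. (\<integral>\<^sup>+x. norm (b (f x) - b (s i x)) \<partial>M)
        \<le> ennreal (norm b) * (\<integral>\<^sup>+x. norm (f x - s i x) \<partial>M)"
      by simp
    show "(\<lambda>i. ennreal (norm b) * (\<integral>\<^sup>+x. norm (f x - s i x) \<partial>M)) \<longlonglongrightarrow> 0"
      using ennreal_tendsto_cmult[OF _ lim, of "ennreal (norm b)"] by simp
  qed auto
  moreover have "(\<lambda>i. Bochner_Integration.simple_bochner_integral M (\<lambda>x. b (s i x))) \<longlonglongrightarrow> b I"
  proof -
    have "Bochner_Integration.simple_bochner_integral M (\<lambda>x. b (s i x)) =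
        b (Bochner_Integration.simple_bochner_integral M (s i))" for i
      by (rule simple_bochner_integral_linear[OF _ s])
        (simp add: blinfun.bounded_linear_right bounded_linear.linear)
    then show ?thesis using int by (auto intro!: tendsto_intros)
  qed
  ultimately show ?thesis
    by (rule has_bochner_integral.intros)
qed

lemma blinfun_real_separates:
  fixes x y :: "'b::real_normed_vector"
  assumes "\<And>b :: 'b \<Rightarrow>\<^sub>L real. norm b \<le> 1 \<Longrightarrow> blinfun_apply b x = blinfun_apply b y"
  shows "x = y"
proof -
  obtain b :: "'b \<Rightarrow>\<^sub>L real" where "norm b \<le> 1" "b (x - y) = norm (x - y)"
    by (rule norming_functional)
  with assms[of b] show ?thesis by (simp add: blinfun.diff_right)
qed

text \<open>Two strong integrals of \<open>f\<close> agree under every functional, hence coincide,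
  which makes the definite description in \<open>strong_integral\<close> meaningful.\<close>

lemma strong_integral_eqI:
  assumes "has_strong_integral M f I"
  shows "strong_integral M f = I"
proof -
  have "J = I" if "has_strong_integral M f J" for J
    by (rule blinfun_real_separates,
      rule has_bochner_integral_eq[OF has_strong_integral_blinfun[OF that] has_strong_integral_blinfun[OF assms]])
  then have "(THE J. has_strong_integral M f J) = I"
    using assms by (intro the_equality) blast+
  moreover have "\<exists>J. has_strong_integral M f J"
    using assms by blast
  ultimately show ?thesis
    by (simp add: strong_integral_def)
qed

text \<open>
  Pettis: on a separable range the norm is a supremum of countably many functionals, so weak
  measurability makes all distances \<open>norm (f x - y)\<close> measurable; nearest points in a countable
  dense set then give simple approximations.
\<close>

lemma weakly_measurable_norm_diff:
  fixes f :: "'a \<Rightarrow> 'b::real_normed_vector"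
  assumes f: "\<And>b :: 'b \<Rightarrow>\<^sub>L real. (\<lambda>x. blinfun_apply b (f x)) \<in> borel_measurable M"
    and D: "countable D" "f ` space M \<subseteq> closure D"
  shows "(\<lambda>x. norm (f x - y)) \<in> borel_measurable M"
proof -
  \<comment> \<open>The functional is chosen to norm \<open>d - y\<close>, not
    \<open>f x - y\<close>, so that only countably many functionals occur.\<close>
  obtain \<beta> :: "'b \<Rightarrow> 'b \<Rightarrow>\<^sub>L real" where \<beta>: "\<And>d. norm (\<beta> d) \<le> 1" "\<And>d. \<beta> d (d - y) = norm (d - y)"
  proof -
    have "\<exists>b :: 'b \<Rightarrow>\<^sub>L real. norm b \<le> 1 \<and> blinfun_apply b (d - y) = norm (d - y)" for d
      using norming_functional[of "d - y"] by blast
    then show ?thesis using that by metis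
  qed
  have \<beta>_le: "\<beta> d v \<le> norm v" for d v
    using norm_blinfun[of "\<beta> d" v] \<beta>(1)[of d] mult_right_mono[of "norm (\<beta> d)" 1 "norm v"] by simp
  have eq: "norm (f x - y) = (SUP d\<in>D. \<beta> d (f x - y))" if x: "x \<in> space M" for x
  proof (rule antisym)
    have bdd: "bdd_above ((\<lambda>d. \<beta> d (f x - y)) ` D)"
      using \<beta>_le by (rule bdd_aboveI2)
    show "norm (f x - y) \<le> (SUP d\<in>D. \<beta> d (f x - y))"
    proof (rule field_le_epsilon)
      fix e :: real assume "e > 0"
      then obtain d where d: "d \<in> D" "dist d (f x) < e / 2"
        using D(2) x closure_approachable[of "f x" D] by (metis half_gt_zero image_subset_iff)
      \<comment> \<open>Replacing \<open>f x\<close> by \<open>d\<close> costs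
        \<open>norm (d - f x)\<close> twice, once in the norm and once under the functional; hence
        the choice of \<open>e / 2\<close>.\<close>
      have "norm (f x - y) \<le> norm (d - y) + norm (d - f x)"
        using norm_triangle_ineq4[of "d - y" "d - f x"] by simp
      also have "norm (d - y) = \<beta> d (f x - y) + \<beta> d (d - f x)"
        by (simp add: \<beta>(2)[symmetric] blinfun.diff_right)
      also have "\<dots> \<le> (SUP d\<in>D. \<beta> d (f x - y)) + norm (d - f x)"
        by (intro add_mono cSUP_upper d bdd \<beta>_le)
      finally show "norm (f x - y) \<le> (SUP d\<in>D. \<beta> d (f x - y)) + e"
        using d(2) by (simp add: dist_norm)
    qed
    have "D \<noteq> {}" using D(2) x by auto
    then show "(SUP d\<in>D. \<beta> d (f x - y)) \<le> norm (f x - y)"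
      by (rule cSUP_least) (rule \<beta>_le)
  qed
  have "(\<lambda>x. SUP d\<in>D. \<beta> d (f x - y)) \<in> borel_measurable M"
  proof (rule borel_measurable_cSUP[OF D(1)])
    show "(\<lambda>x. \<beta> d (f x - y)) \<in> borel_measurable M" for d
      using f[of "\<beta> d"] by (simp add: blinfun.diff_right)
    show "bdd_above ((\<lambda>d. \<beta> d (f x - y)) ` D)" for x
      using \<beta>_le by (rule bdd_aboveI2)
  qed
  then show ?thesis
    by (rule measurable_cong[THEN iffD1, rotated]) (simp add: eq)
qed

lemma weakly_measurable_simple_approx:
  fixes f :: "'a \<Rightarrow> 'b::real_normed_vector"
  assumes f: "\<And>b :: 'b \<Rightarrow>\<^sub>L real. (\<lambda>x. blinfun_apply b (f x)) \<in> borel_measurable M"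
    and D: "countable D" "f ` space M \<subseteq> closure D" "D \<noteq> {}"
  obtains s :: "nat \<Rightarrow> 'a \<Rightarrow> 'b" where "\<And>i. simple_function M (s i)" "\<And>i x. s i x \<in> D"
    "\<And>i. (\<lambda>x. norm (f x - s i x)) \<in> borel_measurable M"
    "\<And>x. x \<in> space M \<Longrightarrow> (\<lambda>i. s i x) \<longlonglongrightarrow> f x"
proof -
  define d where "d = from_nat_into D"
  have range_d: "range d = D"
    using D by (simp add: d_def range_from_nat_into)
  \<comment> \<open>\<open>s n x\<close> is a point nearest to \<open>f x\<close> among
    \<open>d 0\<close>, ..., \<open>d n\<close>, found as a running minimum. It changes only on a
    set described by distances, so measurability of the distances passes through the
    induction.\<close>
  define s where "s = rec_nat (\<lambda>_. d 0)
    (\<lambda>n t x. if norm (f x - d (Suc n)) < norm (f x - t x) then d (Suc n) else t x)"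
  have s_0: "s 0 = (\<lambda>_. d 0)"
    and s_Suc: "s (Suc n) = (\<lambda>x. if norm (f x - d (Suc n)) < norm (f x - s n x) then d (Suc n) else s n x)"
    for n unfolding s_def by simp_all
  have [measurable]: "(\<lambda>x. norm (f x - y)) \<in> borel_measurable M" for y
    by (rule weakly_measurable_norm_diff[OF f D(1,2)])
  have m: "simple_function M (s n) \<and> (\<lambda>x. norm (f x - s n x)) \<in> borel_measurable M" for n
  proof (induction n)
    case 0
    show ?case by (simp add: s_0)
  next
    case (Suc n)
    then have [measurable]: "(\<lambda>x. norm (f x - s n x)) \<in> borel_measurable M" by simp
    have "{x \<in> space M. norm (f x - d (Suc n)) < norm (f x - s n x)} \<in> sets M"
      by measurable
    then have "simple_function M (s (Suc n))"
      using Suc by (simp add: s_Suc simple_function_If)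
    moreover have "(\<lambda>x. norm (f x - s (Suc n) x)) =
        (\<lambda>x. min (norm (f x - d (Suc n))) (norm (f x - s n x)))"
      by (auto simp: s_Suc min_def)
    moreover have "(\<lambda>x. min (norm (f x - d (Suc n))) (norm (f x - s n x))) \<in> borel_measurable M"
      by measurable
    ultimately show ?case by simp
  qed
  have "s n x \<in> D" for n x
    by (induction n) (use range_d in \<open>auto simp: s_0 s_Suc\<close>)
  moreover have "(\<lambda>i. s i x) \<longlonglongrightarrow> f x" if x: "x \<in> space M" for x
  proof (rule metric_LIMSEQ_I)
    fix e :: real assume "e > 0"
    then obtain y where "y \<in> D" "dist y (f x) < e"
      using D(2) x closure_approachable[of "f x" D] by (metis image_subset_iff)
    then obtain k where k: "norm (f x - d k) < e"
      using range_d by (auto simp: dist_norm norm_minus_commute)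
    have "norm (f x - s n x) < e" if "n \<ge> k" for n
      using that
    proof (induction n rule: dec_induct)
      case base
      show ?case using k by (cases k) (auto simp: s_0 s_Suc)
    next
      case (step n)
      then show ?case by (auto simp: s_Suc)
    qed
    then show "\<exists>no. \<forall>n\<ge>no. dist (s n x) (f x) < e"
      by (auto simp: dist_norm norm_minus_commute)
  qed
  ultimately show ?thesis
    using that[of s] m by blast
qed

text \<open>Both simple functions are compared with \<open>f\<close> by the triangle inequality.
  This makes the integrals of an approximating sequence Cauchy.\<close>

lemma norm_simple_bochner_integral_diff_le:
  assumes s: "Bochner_Integration.simple_bochner_integrable M s"
    and t: "Bochner_Integration.simple_bochner_integrable M t"
    and [measurable]: "(\<lambda>x. norm (f x - s x)) \<in> borel_measurable M"
      "(\<lambda>x. norm (f x - t x)) \<in> borel_measurable M"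
  shows "ennreal (norm (Bochner_Integration.simple_bochner_integral M s -
      Bochner_Integration.simple_bochner_integral M t)) \<le>
    (\<integral>\<^sup>+ x. norm (f x - s x) \<partial>M) + (\<integral>\<^sup>+ x. norm (f x - t x) \<partial>M)"
proof -
  have st: "Bochner_Integration.simple_bochner_integrable M (\<lambda>x. s x - t x)"
    using simple_bochner_integrable_compose2[of "(-)", OF _ s t] by simp
  have n: "Bochner_Integration.simple_bochner_integrable M (\<lambda>x. norm (s x - t x))"
    using simple_bochner_integrable_compose2[of "\<lambda>x y. norm (x - y)", OF _ s t] by simp
  have "norm (Bochner_Integration.simple_bochner_integral M s -
      Bochner_Integration.simple_bochner_integral M t)
      \<le> Bochner_Integration.simple_bochner_integral M (\<lambda>x. norm (s x - t x))"
    using simple_bochner_integral_norm_bound[OF st] by (simp add: simple_bochner_integral_diff[OF s t])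
  then have "ennreal (norm (Bochner_Integration.simple_bochner_integral M s -
      Bochner_Integration.simple_bochner_integral M t)) \<le> (\<integral>\<^sup>+ x. norm (s x - t x) \<partial>M)"
    by (simp add: simple_bochner_integral_eq_nn_integral[OF n, symmetric] ennreal_leI)
  also have "\<dots> \<le> (\<integral>\<^sup>+x. ennreal (norm (f x - s x)) + ennreal (norm (f x - t x)) \<partial>M)"
  proof (rule nn_integral_mono)
    fix x
    have "norm (s x - t x) \<le> norm (f x - s x) + norm (f x - t x)"
      by (metis norm_diff_triangle_le norm_minus_commute order_refl)
    then show "ennreal (norm (s x - t x)) \<le> ennreal (norm (f x - s x)) + ennreal (norm (f x - t x))"
      by (metis ennreal_leI ennreal_plus norm_ge_zero)
  qed
  also have "\<dots> = (\<integral>\<^sup>+ x. norm (f x - s x) \<partial>M) + (\<integral>\<^sup>+ x. norm (f x - t x) \<partial>M)"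
    by (rule nn_integral_add) auto
  finally show ?thesis .
qed

text \<open>The approximants take values in \<open>D\<close>, so they share the bound
  \<open>C\<close> with \<open>f\<close> and the errors are dominated by \<open>2 * C\<close> on the
  set \<open>A\<close> of finite measure. Dominated convergence then gives convergence in mean, and
  completeness of the space a limit of the integrals.\<close>

lemma has_strong_integral_indicator_exists:
  fixes f :: "'a \<Rightarrow> 'b::banach"
  assumes f: "\<And>b :: 'b \<Rightarrow>\<^sub>L real. (\<lambda>x. blinfun_apply b (f x)) \<in> borel_measurable M"
    and D: "countable D" "f ` space M \<subseteq> closure D" "D \<noteq> {}"
    and C: "\<And>x. x \<in> space M \<Longrightarrow> norm (f x) \<le> C" "\<And>d. d \<in> D \<Longrightarrow> norm d \<le> C"
    and A [measurable]: "A \<in> sets M" and fin: "emeasure M A < \<infinity>"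
  obtains I where "has_strong_integral M (\<lambda>x. indicator A x *\<^sub>R f x) I"
proof -
  obtain t :: "nat \<Rightarrow> 'a \<Rightarrow> 'b" where t: "\<And>i. simple_function M (t i)" "\<And>i x. t i x \<in> D"
    and m: "\<And>i. (\<lambda>x. norm (f x - t i x)) \<in> borel_measurable M"
    and lim: "\<And>x. x \<in> space M \<Longrightarrow> (\<lambda>i. t i x) \<longlonglongrightarrow> f x"
    using weakly_measurable_simple_approx[OF f D] by metis
  note m[measurable]
  let ?f = "\<lambda>x. indicator A x *\<^sub>R f x" and ?s = "\<lambda>i x. indicator A x *\<^sub>R t i x"
  let ?J = "\<lambda>i. Bochner_Integration.simple_bochner_integral M (?s i)"
  have sf: "simple_function M (?s i)" for i
    by (rule simple_function_compose2[OF simple_function_indicator[OF A] t(1)])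
  have s: "Bochner_Integration.simple_bochner_integrable M (?s i)" for i
  proof
    have "emeasure M {x \<in> space M. ?s i x \<noteq> 0} \<le> emeasure M A"
      by (rule emeasure_mono) (auto simp: indicator_def)
    with fin show "emeasure M {x \<in> space M. ?s i x \<noteq> 0} \<noteq> \<infinity>" by auto
  qed (rule sf)
  have norm_eq: "norm (?f x - ?s i x) = indicator A x * norm (f x - t i x)" for i x
    by (simp add: indicator_def)
  have mn: "(\<lambda>x. norm (?f x - ?s i x)) \<in> borel_measurable M" for i
    unfolding norm_eq by measurable
  have lim_nn: "(\<lambda>i. \<integral>\<^sup>+x. norm (?f x - ?s i x) \<partial>M) \<longlonglongrightarrow> 0"
  proof -
    \<comment> \<open>Dominated convergence is applied to the real-valued errors, with limit
      function 0, instead of the vector-valued approximants.\<close>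
    have "(\<lambda>i. \<integral>\<^sup>+x. norm (0 - indicator A x * norm (f x - t i x)) \<partial>M) \<longlonglongrightarrow> 0"
    proof (rule nn_integral_dominated_convergence_norm[where w = "\<lambda>x. 2 * C * indicator A x"])
      show "AE x in M. norm (indicator A x * norm (f x - t i x)) \<le> 2 * C * indicator A x" for i
      proof (rule AE_I2)
        fix x assume "x \<in> space M"
        then have "norm (f x - t i x) \<le> 2 * C"
          using C(1)[of x] C(2)[OF t(2), of i x] norm_triangle_ineq4[of "f x" "t i x"] by linarith
        then show "norm (indicator A x * norm (f x - t i x)) \<le> 2 * C * indicator A x"
          by (simp add: indicator_def)
      qed
      have "(\<integral>\<^sup>+x. ennreal (2 * C * indicator A x) \<partial>M) = (\<integral>\<^sup>+x. ennreal (2 * C) * indicator A x \<partial>M)"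
        by (intro nn_integral_cong) (simp add: indicator_def)
      also have "\<dots> = ennreal (2 * C) * emeasure M A"
        by (simp add: nn_integral_cmult_indicator)
      also have "\<dots> < \<infinity>"
        using fin by (simp add: ennreal_mult_less_top)
      finally show "(\<integral>\<^sup>+x. ennreal (2 * C * indicator A x) \<partial>M) < \<infinity>" .
      show "AE x in M. (\<lambda>i. indicator A x * norm (f x - t i x)) \<longlonglongrightarrow> 0"
      proof (rule AE_I2)
        fix x assume "x \<in> space M"
        from tendsto_mult_right_zero[OF tendsto_norm_zero[OF LIM_zero[OF lim[OF this]]]]
        show "(\<lambda>i. indicator A x * norm (f x - t i x)) \<longlonglongrightarrow> 0"
          by (simp add: norm_minus_commute)
      qed
    qed measurable
    then show ?thesis by (simp add: norm_eq)
  qed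
  have "Cauchy ?J"
  proof (rule metric_CauchyI)
    fix e :: real assume "0 < e"
    then have "0 < ennreal (e / 2)" by simp
    from order_tendstoD(2)[OF lim_nn this]
    obtain N where N: "\<And>n. n \<ge> N \<Longrightarrow> (\<integral>\<^sup>+x. norm (?f x - ?s n x) \<partial>M) < ennreal (e / 2)"
      by (auto simp: eventually_sequentially)
    have "dist (?J n) (?J k) < e" if "n \<ge> N" "k \<ge> N" for n k
    proof -
      have "ennreal (norm (?J n - ?J k)) < ennreal (e / 2) + ennreal (e / 2)"
        using norm_simple_bochner_integral_diff_le[OF s s mn mn, of n k]
        by (rule le_less_trans) (intro add_strict_mono N that)
      also have "\<dots> = ennreal e"
        using \<open>0 < e\<close> by (simp flip: ennreal_plus)
      finally show ?thesis
        using \<open>0 < e\<close> by (simp add: dist_norm ennreal_less_iff)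
    qed
    then show "\<exists>N. \<forall>n\<ge>N. \<forall>k\<ge>N. dist (?J n) (?J k) < e" by blast
  qed
  then obtain I where "?J \<longlonglongrightarrow> I"
    by (auto simp: Cauchy_convergent_iff convergent_def)
  moreover have "strongly_measurable M ?f"
    unfolding strongly_measurable_def
    using sf lim by (intro exI[of _ ?s]) (auto intro: tendsto_intros)
  ultimately have "has_strong_integral M ?f I"
    unfolding has_strong_integral_def
    by (intro conjI exI[of _ ?s] allI) (assumption | rule s lim_nn)+
  with that show ?thesis .
qed

section \<open>Ergodic averages of a group action\<close>

locale folner_action =
  fixes M :: "'g::{topological_group_add, t2_space, second_countable_topology} measure"
    and F :: "nat \<Rightarrow> 'g set"
    and \<pi> :: "'g \<Rightarrow> 'b::banach \<Rightarrow>\<^sub>L 'b"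
  assumes haar: "left_haar_measure M"
    and folner: "folner_sequence M F"
    and action: "acts_borel_strongly \<pi>"
begin

abbreviation average :: "nat \<Rightarrow> 'b \<Rightarrow> 'b"
  where "average n x \<equiv> ergodic_average M F \<pi> x n"

section \<open>Translations and Haar measure\<close>

lemma space_M [simp]: "space M = UNIV"
  using haar by (simp add: left_haar_measure_def)

lemma borel_measurable_haar: "f \<in> measurable borel N \<Longrightarrow> f \<in> measurable M N"
  using haar by (auto simp: left_haar_measure_def measurable_def)

lemma F_sets [measurable, simp]: "F n \<in> sets M"
  using haar folner borel_compact[of "F n"] by (auto simp: left_haar_measure_def folner_sequence_def)

lemma F_finite: "emeasure M (F n) < \<infinity>"
  using haar folner by (auto simp: left_haar_measure_def folner_sequence_def)

lemma F_pos: "0 < measure M (F n)"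
  using folner by (auto simp: folner_sequence_def)

lemma haar_translate:
  assumes "A \<in> sets M"
  shows "(+) g ` A \<in> sets M" "emeasure M ((+) g ` A) = emeasure M A"
  using haar assms unfolding left_haar_measure_def by blast+

text \<open>\<open>M\<close> may have more measurable sets than the Borel ones, so continuity is not
  enough; the preimage of a set under translation by \<open>g\<close> is its translate by
  \<open>- g\<close>.\<close>

lemma measurable_translate: "(+) g \<in> measurable M M"
proof (rule measurableI)
  fix A assume "A \<in> sets M"
  moreover have "(+) g -` A \<inter> space M = (+) (- g) ` A"
    by (force simp: image_iff algebra_simps add.assoc[symmetric])
  ultimately show "(+) g -` A \<inter> space M \<in> sets M"
    by (simp add: haar_translate)
qed simp

lemma distr_translate: "distr M M ((+) g) = M"
proof (rule measure_eqI)
  fix A assume "A \<in> sets (distr M M ((+) g))"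
  then have A: "A \<in> sets M" by simp
  have "(+) g -` A \<inter> space M = (+) (- g) ` A"
    by (force simp: image_iff algebra_simps add.assoc[symmetric])
  with A show "emeasure (distr M M ((+) g)) A = emeasure M A"
    by (simp add: emeasure_distr measurable_translate haar_translate)
qed simp

section \<open>Orbits and their scalar coefficients\<close>

lemma action_add: "\<pi> (g + h) x = \<pi> g (\<pi> h x)"
  using action by (simp add: acts_borel_strongly_def)

lemma norm_action_le: "norm (\<pi> g x) \<le> norm x"
  using action norm_blinfun[of "\<pi> g" x] by (simp add: acts_borel_strongly_def)

lemma functional_action_le:
  fixes b :: "'b \<Rightarrow>\<^sub>L real"
  assumes "norm b \<le> 1"
  shows "\<bar>b (\<pi> g x)\<bar> \<le> norm x"
proof -
  have "\<bar>b (\<pi> g x)\<bar> \<le> norm b * norm (\<pi> g x)"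
    using norm_blinfun[of b "\<pi> g x"] by simp
  also have "\<dots> \<le> 1 * norm x"
    using assms by (intro mult_mono norm_action_le) auto
  finally show ?thesis by simp
qed

lemma borel_measurable_orbit [measurable]:
  fixes b :: "'b \<Rightarrow>\<^sub>L real"
  shows "(\<lambda>g. b (\<pi> (- g) x)) \<in> borel_measurable borel"
proof -
  have "(\<lambda>g::'g. - g) \<in> borel_measurable borel"
    by (intro borel_measurable_continuous_onI continuous_intros)
  moreover have "(\<lambda>g. b (\<pi> g x)) \<in> borel_measurable borel"
    using action by (simp add: acts_borel_strongly_def)
  ultimately show ?thesis
    by (rule measurable_compose)
qed

text \<open>The restriction is a finite measure, so bounded measurable functions are integrable and
  Fubini's theorem applies.\<close>

definition on_F :: "nat \<Rightarrow> 'g measure"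
  where "on_F n = restrict_space M (F n)"

lemma space_on_F [simp]: "space (on_F n) = F n"
  by (simp add: on_F_def space_restrict_space)

lemma measure_on_F: "A \<in> sets M \<Longrightarrow> A \<subseteq> F n \<Longrightarrow> measure (on_F n) A = measure M A"
  by (simp add: on_F_def measure_restrict_space)

lemma finite_measure_on_F: "finite_measure (on_F n)"
  by (rule finite_measureI) (use F_finite[of n] in \<open>simp add: on_F_def emeasure_restrict_space\<close>)

lemma borel_measurable_on_F: "f \<in> measurable borel N \<Longrightarrow> f \<in> measurable (on_F n) N"
  unfolding on_F_def by (intro measurable_restrict_space1 borel_measurable_haar)

lemma integrable_orbit:
  fixes b :: "'b \<Rightarrow>\<^sub>L real"
  assumes "norm b \<le> 1"
  shows "integrable (on_F n) (\<lambda>g. b (\<pi> (- g) x))"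
proof -
  interpret finite_measure "on_F n" by (rule finite_measure_on_F)
  show ?thesis
    by (rule integrable_const_bound[where B = "norm x"])
      (simp_all add: functional_action_le assms borel_measurable_on_F borel_measurable_orbit)
qed

text \<open>Separability of the orbit makes the integral exist, so the default value 0 of
  \<open>strong_integral\<close> does not enter. All properties of the averages are read off from
  this scalar formula.\<close>

lemma functional_average:
  fixes b :: "'b \<Rightarrow>\<^sub>L real"
  shows "b (average n x) = (\<integral>g. b (\<pi> (- g) x) \<partial>on_F n) / measure M (F n)"
proof -
  have "separable_space (top_of_set (range (\<lambda>g. \<pi> g x)))"
    using action by (simp add: acts_borel_strongly_def)
  then obtain D where D: "countable D" "D \<subseteq> range (\<lambda>g. \<pi> g x)"
    "top_of_set (range (\<lambda>g. \<pi> g x)) closure_of D = range (\<lambda>g. \<pi> g x)"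
    unfolding separable_space_def by auto
  then have cl: "range (\<lambda>g. \<pi> g x) \<subseteq> closure D"
    by (auto simp: closure_of_subtopology inf.absorb2 Int_absorb1)
  obtain I where I: "has_strong_integral M (\<lambda>g. indicator (F n) g *\<^sub>R \<pi> (- g) x) I"
  proof (rule has_strong_integral_indicator_exists[where f = "\<lambda>g. \<pi> (- g) x" and A = "F n"])
    show "(\<lambda>g. blinfun_apply b (\<pi> (- g) x)) \<in> borel_measurable M" for b :: "'b \<Rightarrow>\<^sub>L real"
      by (intro borel_measurable_haar borel_measurable_orbit)
    show "(\<lambda>g. \<pi> (- g) x) ` space M \<subseteq> closure D" "D \<noteq> {}"
      using cl by auto
    show "norm (\<pi> (- g) x) \<le> norm x" for g by (rule norm_action_le)
    \<comment> \<open>The dense set lies in the orbit, and the action does not increase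
      norms.\<close>
    show "norm d \<le> norm x" if "d \<in> D" for d
      using that D(2) norm_action_le by auto
  qed (use D(1) F_finite F_sets in blast)+
  have "has_bochner_integral M (\<lambda>g. indicator (F n) g *\<^sub>R b (\<pi> (- g) x)) (b I)"
    using has_strong_integral_blinfun[OF I, of b] by (simp add: blinfun.scaleR_right)
  then have "has_bochner_integral (on_F n) (\<lambda>g. b (\<pi> (- g) x)) (b I)"
    by (simp add: on_F_def has_bochner_integral_restrict_space)
  then show ?thesis
    by (simp add: ergodic_average_def strong_integral_eqI[OF I] blinfun.scaleR_right
        has_bochner_integral_integral_eq)
qed

section \<open>Averages as linear contractions\<close>

lemma average_add: "average n (x + y) = average n x + average n y"
  by (rule blinfun_real_separates)
    (simp add: functional_average blinfun.add_right integrable_orbit add_divide_distrib)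

lemma average_scaleR: "average n (c *\<^sub>R x) = c *\<^sub>R average n x"
  by (rule blinfun_real_separates) (simp add: functional_average blinfun.scaleR_right)

lemma norm_average_le: "norm (average n x) \<le> norm x"
proof -
  interpret finite_measure "on_F n" by (rule finite_measure_on_F)
  obtain b :: "'b \<Rightarrow>\<^sub>L real" where b: "norm b \<le> 1" "b (average n x) = norm (average n x)"
    by (rule norming_functional)
  have "(\<integral>g. b (\<pi> (- g) x) \<partial>on_F n) \<le> (\<integral>g. norm x \<partial>on_F n)"
    using functional_action_le[OF b(1)] by (intro integral_mono integrable_orbit b) (auto simp: abs_le_iff)
  also have "\<dots> = measure M (F n) * norm x"
    by (simp add: measure_on_F)
  finally show ?thesis
    using b(2) F_pos[of n] by (simp add: functional_average field_simps)
qed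

text \<open>Left invariance turns the first integral into that of \<open>\<phi>\<close> over the
  translate of \<open>F m\<close> by \<open>g\<close>. The two integrals cancel except on the
  symmetric difference, where \<open>\<phi>\<close> is bounded by \<open>C\<close>.\<close>

lemma integral_translate_diff_le:
  assumes \<phi>: "\<phi> \<in> borel_measurable borel" "\<And>h. \<bar>\<phi> h\<bar> \<le> (C::real)"
  shows "\<bar>(\<integral>h. \<phi> (g + h) \<partial>on_F m) - (\<integral>h. \<phi> h \<partial>on_F m)\<bar>
    \<le> C * measure M (sym_diff (F m) ((+) g ` F m))"
proof -
  let ?gF = "(+) g ` F m"
  note [measurable] = borel_measurable_haar[OF \<phi>(1)] measurable_translate
  have gF [measurable]: "?gF \<in> sets M" and gF_fin: "emeasure M ?gF < \<infinity>"
    using F_finite[of m] by (simp_all add: haar_translate)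
  have int: "integrable M (\<lambda>h. indicator A h * \<phi> h)" if [measurable]: "A \<in> sets M" and "emeasure M A < \<infinity>" for A
  proof (rule Bochner_Integration.integrable_bound[of M "\<lambda>h. C * indicator A h"])
    show "AE h in M. norm (indicator A h * \<phi> h) \<le> norm (C * indicator A h)"
      using \<phi>(2) by (intro AE_I2) (auto simp: indicator_def intro: order_trans[OF _ abs_ge_self])
  qed (use that in \<open>auto simp: integrable_indicator_iff\<close>)
  have "(\<integral>h. \<phi> (g + h) \<partial>on_F m) = (\<integral>h. indicator (F m) h * \<phi> (g + h) \<partial>M)"
    by (simp add: on_F_def integral_restrict_space)
  also have "\<dots> = (\<integral>h. indicator ?gF (g + h) * \<phi> (g + h) \<partial>M)"
    by (intro Bochner_Integration.integral_cong) (auto simp: indicator_def)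
  also have "\<dots> = (\<integral>h. indicator ?gF h * \<phi> h \<partial>distr M M ((+) g))"
    by (subst integral_distr) auto
  finally have "(\<integral>h. \<phi> (g + h) \<partial>on_F m) - (\<integral>h. \<phi> h \<partial>on_F m)
      = (\<integral>h. indicator ?gF h * \<phi> h \<partial>M) - (\<integral>h. indicator (F m) h * \<phi> h \<partial>M)"
    by (simp add: distr_translate) (simp add: on_F_def integral_restrict_space)
  also have "\<dots> = (\<integral>h. indicator ?gF h * \<phi> h - indicator (F m) h * \<phi> h \<partial>M)"
    by (intro Bochner_Integration.integral_diff[symmetric] int gF_fin F_finite) auto
  also have "\<bar>\<dots>\<bar> \<le> (\<integral>h. C * indicator (sym_diff (F m) ?gF) h \<partial>M)"
  proof -
    have fin: "emeasure M (sym_diff (F m) ?gF) < \<infinity>"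
    proof -
      have "emeasure M (sym_diff (F m) ?gF) \<le> emeasure M (F m \<union> ?gF)"
        by (intro emeasure_mono) auto
      also have "\<dots> \<le> emeasure M (F m) + emeasure M ?gF"
        by (intro emeasure_subadditive) auto
      also have "\<dots> < \<infinity>"
        using F_finite[of m] gF_fin by simp
      finally show ?thesis .
    qed
    then have "integrable M (\<lambda>h. C * indicator (sym_diff (F m) ?gF) h)"
      by (intro integrable_mult_right) (simp add: integrable_indicator_iff)
    moreover have "integrable M (\<lambda>h. indicator ?gF h * \<phi> h - indicator (F m) h * \<phi> h)"
      by (intro Bochner_Integration.integrable_diff int gF_fin F_finite) auto
    ultimately have "(\<integral>h. \<bar>indicator ?gF h * \<phi> h - indicator (F m) h * \<phi> h\<bar> \<partial>M)
        \<le> (\<integral>h. C * indicator (sym_diff (F m) ?gF) h \<partial>M)"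
      using \<phi>(2) by (intro integral_mono integrable_abs) (auto simp: indicator_def)
    then show ?thesis
      by (rule order_trans[OF integral_abs_bound])
  qed
  also have "\<dots> = C * measure M (sym_diff (F m) ?gF)"
    by simp
  finally show ?thesis .
qed

text \<open>Up to normalisation, the difference is an average over \<open>g\<close> in
  \<open>F n\<close> of the translation errors of \<open>F m\<close>. Points of \<open>F'\<close>
  contribute at most \<epsilon>. The exceptional points have proportion at most \<epsilon> and
  contribute at most 2 each by the trivial bound, whence the factor 3.\<close>

lemma norm_average_average_diff_le:
  assumes F': "F' \<in> sets M" "F' \<subseteq> F n" "measure M (F n - F') \<le> measure M (F n) * \<epsilon>"
    and inv: "\<And>g. g \<in> F' \<Longrightarrow>
      measure M (sym_diff (F m) ((+) g ` F m)) / measure M (F m) \<le> \<epsilon>"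
  shows "norm (average m (average n x) - average m x) \<le> 3 * \<epsilon> * norm x"
proof -
  let ?\<mu> = "\<lambda>n. measure M (F n)"
  interpret m: finite_measure "on_F m" by (rule finite_measure_on_F)
  interpret n: finite_measure "on_F n" by (rule finite_measure_on_F)
  interpret pair_sigma_finite "on_F n" "on_F m" ..
  interpret nm: finite_measure "on_F n \<Otimes>\<^sub>M on_F m"
    by (rule finite_measure_pair_measure) unfold_locales
  obtain b :: "'b \<Rightarrow>\<^sub>L real" where b: "norm b \<le> 1"
    "b (average m (average n x) - average m x) = norm (average m (average n x) - average m x)"
    by (rule norming_functional)
  define \<phi> where "\<phi> k = b (\<pi> (- k) x)" for k
  have \<phi>_borel [measurable]: "\<phi> \<in> borel_measurable borel"
    unfolding \<phi>_def by (rule borel_measurable_orbit)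
  have \<phi>_le: "\<bar>\<phi> k\<bar> \<le> norm x" for k
    unfolding \<phi>_def by (rule functional_action_le[OF b(1)])
  \<comment> \<open>With the identity measurable into the Borel sets, \<open>g + h\<close> is
    jointly measurable on the product, because the group has a countable base.\<close>
  have [measurable]: "(\<lambda>g. g) \<in> borel_measurable (on_F k)" for k
    by (rule borel_measurable_on_F) simp
  have int: "integrable (on_F n \<Otimes>\<^sub>M on_F m) (\<lambda>(g, h). \<phi> (g + h))"
    by (rule nm.integrable_const_bound[where B = "norm x"]) (auto simp: \<phi>_le)
  have int_F: "integrable (on_F n) (\<lambda>g. \<integral>h. \<phi> (g + h) \<partial>on_F m)"
    using integrable_fst'[OF int] by simp
  have S: "(F n - F') \<inter> F n = F n - F'" "F n - F' \<in> sets (on_F n)"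
    using F' by (auto simp: on_F_def sets_restrict_space_iff)
  then have int_S: "integrable (on_F n) (\<lambda>g. indicator (F n - F') g :: real)"
    by (simp add: integrable_indicator_iff less_top[symmetric])
  \<comment> \<open>The inverses reverse the order of composition, so \<open>\<phi>\<close> is
    evaluated at \<open>g + h\<close> with \<open>g\<close> on the left, as left invariance
    requires.\<close>
  have "b (\<pi> (- h) (average n x)) = (\<integral>g. \<phi> (g + h) \<partial>on_F n) / ?\<mu> n" for h
  proof -
    have "\<phi> (g + h) = b (\<pi> (- h) (\<pi> (- g) x))" for g
      by (simp only: \<phi>_def minus_add action_add)
    then show ?thesis
      using functional_average[of "b o\<^sub>L \<pi> (- h)"] by simp
  qed
  then have "b (average m (average n x)) = (\<integral>h. \<integral>g. \<phi> (g + h) \<partial>on_F n \<partial>on_F m) / (?\<mu> n * ?\<mu> m)"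
    by (simp add: functional_average)
  \<comment> \<open>After the exchange the inner integral runs over \<open>F m\<close> with
    \<open>g\<close> fixed, where \<open>integral_translate_diff_le\<close> applies.\<close>
  also have "(\<integral>h. \<integral>g. \<phi> (g + h) \<partial>on_F n \<partial>on_F m) = (\<integral>g. \<integral>h. \<phi> (g + h) \<partial>on_F m \<partial>on_F n)"
    by (rule Fubini_integral) (use int in simp)
  finally have "norm (average m (average n x) - average m x) =
      (\<integral>g. (\<integral>h. \<phi> (g + h) \<partial>on_F m) - (\<integral>h. \<phi> h \<partial>on_F m) \<partial>on_F n) / (?\<mu> n * ?\<mu> m)"
    using F_pos[of n] F_pos[of m] int_F
    by (simp add: b(2)[symmetric] blinfun.diff_right functional_average[where x = x] \<phi>_def[symmetric]
        measure_on_F diff_divide_distrib)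
  also have "(\<integral>g. (\<integral>h. \<phi> (g + h) \<partial>on_F m) - (\<integral>h. \<phi> h \<partial>on_F m) \<partial>on_F n)
      \<le> (\<integral>g. norm x * ?\<mu> m * \<epsilon> + 2 * norm x * ?\<mu> m * indicator (F n - F') g \<partial>on_F n)"
  proof (rule integral_mono)
    show "integrable (on_F n) (\<lambda>g. (\<integral>h. \<phi> (g + h) \<partial>on_F m) - (\<integral>h. \<phi> h \<partial>on_F m))"
      using int_F by simp
    show "integrable (on_F n) (\<lambda>g. norm x * ?\<mu> m * \<epsilon> + 2 * norm x * ?\<mu> m * indicator (F n - F') g)"
      by (intro Bochner_Integration.integrable_add integrable_mult_right n.integrable_const int_S)
  next
    fix g assume g: "g \<in> space (on_F n)"
    let ?S = "sym_diff (F m) ((+) g ` F m)"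
    have diff: "(\<integral>h. \<phi> (g + h) \<partial>on_F m) - (\<integral>h. \<phi> h \<partial>on_F m) \<le> norm x * measure M ?S"
      using integral_translate_diff_le[OF \<phi>_borel \<phi>_le, where g = g and m = m] by linarith
    show "(\<integral>h. \<phi> (g + h) \<partial>on_F m) - (\<integral>h. \<phi> h \<partial>on_F m)
        \<le> norm x * ?\<mu> m * \<epsilon> + 2 * norm x * ?\<mu> m * indicator (F n - F') g"
    proof (cases "g \<in> F'")
      case True
      with inv[OF True] F_pos[of m] have "measure M ?S \<le> ?\<mu> m * \<epsilon>"
        by (simp add: field_simps)
      then have "norm x * measure M ?S \<le> norm x * (?\<mu> m * \<epsilon>)"
        by (intro mult_left_mono) auto
      with diff True show ?thesis by (simp add: mult.assoc)
    next
      case False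
      \<comment> \<open>At exceptional points each of the two integrals is merely bounded by
        \<open>norm x\<close> times the measure of \<open>F m\<close>.\<close>
      have "(\<integral>h. \<phi> (g + h) \<partial>on_F m) \<le> (\<integral>h. norm x \<partial>on_F m)"
        by (intro integral_mono m.integrable_const m.integrable_const_bound[where B = "norm x"])
          (use \<phi>_le in \<open>auto simp: abs_le_iff\<close>)
      moreover have "(\<integral>h. - norm x \<partial>on_F m) \<le> (\<integral>h. \<phi> h \<partial>on_F m)"
        by (intro integral_mono m.integrable_const m.integrable_const_bound[where B = "norm x"])
          (use \<phi>_le in \<open>auto simp: abs_le_iff minus_le_iff\<close>)
      ultimately have "(\<integral>h. \<phi> (g + h) \<partial>on_F m) - (\<integral>h. \<phi> h \<partial>on_F m) \<le> 2 * norm x * ?\<mu> m"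
        by (simp add: measure_on_F algebra_simps)
      moreover have "0 \<le> \<epsilon>"
        using order_trans[OF measure_nonneg F'(3)] F_pos[of n] by (simp add: zero_le_mult_iff)
      ultimately show ?thesis
        using False g by (simp add: add_increasing)
    qed
  qed
  also have "\<dots> = norm x * ?\<mu> m * (?\<mu> n * \<epsilon> + 2 * measure M (F n - F'))"
    using F' S by (subst Bochner_Integration.integral_add) (simp_all add: int_S measure_on_F algebra_simps)
  also have "\<dots> \<le> norm x * ?\<mu> m * (3 * ?\<mu> n * \<epsilon>)"
    using F'(3) by (intro mult_left_mono) (auto simp: mult.commute)
  finally show ?thesis
    using F_pos[of n] F_pos[of m] by (simp add: divide_right_mono field_simps)
qed

end

text \<open>By linearity, averaging the midpoint gives the midpoint of two vectors within \<eta> of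
  \<open>average m x\<close>, and averaging does not increase the norm. The factor
  \<open>3 * norm x\<close> in the speed cancels the one in the previous estimate.\<close>

lemma (in folner_action) norm_average_le_midpoint:
  assumes fast: "fast_sequence M F l (\<eta> / (3 * norm x))" and "x \<noteq> 0"
    and "k + l \<le> m" "n + l \<le> m"
  shows "norm (average m x) \<le> norm ((1/2) *\<^sub>R (average k x + average n x)) + \<eta>"
proof -
  have diff: "norm (average m (average i x) - average m x) \<le> \<eta>" if i: "i + l \<le> m" for i
  proof -
    obtain F' where "F' \<in> sets M" "F' \<subseteq> F i"
      "measure M (F i - F') < measure M (F i) * (\<eta> / (3 * norm x))"
      "\<And>g. g \<in> F' \<Longrightarrow>
        measure M (sym_diff (F m) ((+) g ` F m)) / measure M (F m) < \<eta> / (3 * norm x)"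
      using fast[unfolded fast_sequence_def, rule_format, OF i] by metis
    then have "norm (average m (average i x) - average m x) \<le> 3 * (\<eta> / (3 * norm x)) * norm x"
      by (intro norm_average_average_diff_le[of F']) (auto intro: less_imp_le)
    with \<open>x \<noteq> 0\<close> show ?thesis by simp
  qed
  let ?y = "(1/2) *\<^sub>R (average k x + average n x)"
  let ?D = "\<lambda>i. average m (average i x) - average m x"
  have "average m ?y - average m x = (1/2) *\<^sub>R (?D k + ?D n)"
  proof -
    have "average m ?y - (1/2) *\<^sub>R (average m x + average m x) = (1/2) *\<^sub>R (?D k + ?D n)"
      by (simp add: average_add average_scaleR scaleR_diff_right scaleR_add_right)
    then show ?thesis
      by (simp flip: scaleR_2)
  qed
  then have "norm (average m ?y - average m x) \<le> \<eta>"
    using norm_triangle_ineq[of "?D k" "?D n"] diff[OF assms(3)] diff[OF assms(4)] by simp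
  moreover have "norm (average m x) \<le> norm (average m ?y) + norm (average m ?y - average m x)"
    by (metis norm_minus_commute norm_triangle_sub)
  ultimately show ?thesis
    using norm_average_le[of ?y m] by linarith
qed

section \<open>Counting fluctuations\<close>

lemma at_most_fluctuations_scaleR:
  fixes s :: "nat \<Rightarrow> 'b::real_normed_vector"
  assumes "c > 0" "at_most_fluctuations N (\<epsilon> / c) s"
  shows "at_most_fluctuations N \<epsilon> (\<lambda>n. c *\<^sub>R s n)"
proof -
  have "\<epsilon> \<le> dist (c *\<^sub>R x) (c *\<^sub>R y) \<longleftrightarrow> \<epsilon> / c \<le> dist x y" for x y :: 'b
    using \<open>c > 0\<close> by (simp add: dist_norm pos_divide_le_eq mult.commute flip: scaleR_diff_right)
  with assms(2) show ?thesis
    by (simp add: at_most_fluctuations_def)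
qed

text \<open>
  The pairs of indices number \<open>q\<close> and \<open>q + 1\<close> with \<open>q = j * (l + 1)\<close> of a fluctuation witness are
  so far apart that the larger norm in a pair exceeds both norms in the next pair by \<open>u \<epsilon> - \<eta>\<close>.
  This is at least \<open>2 * (u \<epsilon> / 2 - \<eta>)\<close>, and the factor 2 pays for the blocks having length \<open>l + 1\<close>
  rather than \<open>l\<close>.
\<close>

lemma at_most_fluctuations_midpoint_decrease:
  fixes a :: "nat \<Rightarrow> 'b::real_normed_vector"
  assumes u: "uniform_convexity_modulus TYPE('b) u" and "\<epsilon> > 0"
    and \<eta>: "\<eta> > 0" "\<eta> < 1/2 * u \<epsilon>" and "l \<ge> 1"
    and R: "R \<le> 1" "\<And>n. norm (a n) \<le> R"
    and mid: "\<And>k n m. k + l \<le> m \<Longrightarrow> n + l \<le> m \<Longrightarrow>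
      norm (a m) \<le> norm ((1/2) *\<^sub>R (a k + a n)) + \<eta>"
  shows "at_most_fluctuations (l * nat \<lfloor>R / (1/2 * u \<epsilon> - \<eta>)\<rfloor> + l) \<epsilon> a"
  unfolding at_most_fluctuations_def
proof (intro allI impI)
  fix ns :: "nat list"
  assume sorted: "sorted_wrt (<) ns"
    and fluct: "\<forall>i. Suc i < length ns \<longrightarrow> \<epsilon> \<le> dist (a (ns ! i)) (a (ns ! Suc i))"
  have gap: "ns ! i + j \<le> ns ! (i + j)" if "i + j < length ns" for i j
    using that
  proof (induction j)
    case (Suc j)
    then have "ns ! (i + j) < ns ! (i + Suc j)"
      by (intro sorted_wrt_nth_less[OF sorted]) auto
    with Suc show ?case by simp
  qed simp
  define v where "v i = max (norm (a (ns ! i))) (norm (a (ns ! Suc i)))" for i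
  have midpoint: "norm ((1/2) *\<^sub>R (a (ns ! i) + a (ns ! Suc i))) \<le> v i - u \<epsilon>"
    if "Suc i < length ns" for i
  proof -
    have convex: "norm ((1/2) *\<^sub>R (x + y)) \<le> norm y - u \<epsilon>"
      if "norm x \<le> norm y" "norm y \<le> 1" "\<epsilon> \<le> dist x y" for x y :: 'b
      using u that \<open>\<epsilon> > 0\<close> unfolding uniform_convexity_modulus_def dist_norm by blast
    have "norm (a n) \<le> 1" for n
      using R order_trans by blast
    then show ?thesis
      using fluct that convex[of "a (ns ! i)" "a (ns ! Suc i)"] convex[of "a (ns ! Suc i)" "a (ns ! i)"]
      by (cases "norm (a (ns ! i)) \<le> norm (a (ns ! Suc i))")
        (auto simp: v_def dist_commute add.commute)
  qed
  have v_le: "v (j * Suc l) \<le> R - j * (u \<epsilon> - \<eta>)" if "Suc (j * Suc l) < length ns" for j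
    using that
  proof (induction j)
    case 0
    then show ?case using R by (simp add: v_def)
  next
    case (Suc j)
    let ?q = "j * Suc l"
    \<comment> \<open>The later member of the pair decides: position \<open>?q + Suc l\<close> is
      \<open>l\<close> places after \<open>Suc ?q\<close>, so \<open>mid\<close> applies to both
      members. Hence blocks of length \<open>l + 1\<close>.\<close>
    have "norm (a (ns ! i)) \<le> v ?q - u \<epsilon> + \<eta>" if "?q + Suc l \<le> i" "i < length ns" for i
    proof -
      have "ns ! ?q + l \<le> ns ! i" "ns ! Suc ?q + l \<le> ns ! i"
        using gap[of ?q "i - ?q"] gap[of "Suc ?q" "i - Suc ?q"] that by auto
      then have "norm (a (ns ! i)) \<le> norm ((1/2) *\<^sub>R (a (ns ! ?q) + a (ns ! Suc ?q))) + \<eta>"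
        by (rule mid)
      with midpoint[of ?q] that show ?thesis by simp
    qed
    then have "v (Suc j * Suc l) \<le> v ?q - u \<epsilon> + \<eta>"
      using Suc.prems by (simp add: v_def)
    with Suc show ?case by (simp add: algebra_simps)
  qed
  show "length ns - 1 \<le> l * nat \<lfloor>R / (1/2 * u \<epsilon> - \<eta>)\<rfloor> + l"
  proof (cases "length ns \<le> 1")
    case False
    define k where "k = length ns - 1"
    \<comment> \<open>The block number \<open>j\<close> is the last one whose initial pair lies in
      the list, so the number \<open>k\<close> of fluctuations is at most
      \<open>(j + 1) * Suc l\<close>.\<close>
    define j where "j = (k - 1) div Suc l"
    have "j * Suc l \<le> k - 1" and k_less: "k - 1 < (j + 1) * Suc l"
      unfolding j_def
      using div_times_less_eq_dividend[of "k - 1" "Suc l"] dividend_less_div_times[of "Suc l" "k - 1"]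
      by (simp_all add: add_mult_distrib)
    then have "Suc (j * Suc l) < length ns"
      using False unfolding k_def by linarith
    \<comment> \<open>The midpoint of the last pair has nonnegative norm, so \<open>v\<close> is
      still at least \<open>u \<epsilon>\<close> there. This accounts for one further decrease,
      hence \<open>j + 1\<close>.\<close>
    from v_le[OF this] order_trans[OF norm_ge_zero midpoint[OF this]]
    have "(j + 1) * (u \<epsilon> - \<eta>) + \<eta> \<le> R"
      by (simp add: algebra_simps)
    moreover have "(j + 1) * (2 * (1/2 * u \<epsilon> - \<eta>)) \<le> (j + 1) * (u \<epsilon> - \<eta>)"
      using \<eta> by (intro mult_left_mono) auto
    ultimately have "(j + 1) * (2 * (1/2 * u \<epsilon> - \<eta>)) \<le> R"
      using \<eta> by linarith
    then have "real (2 * (j + 1)) * (1/2 * u \<epsilon> - \<eta>) \<le> R"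
      by (simp add: algebra_simps)
    then have "real (2 * (j + 1)) \<le> R / (1/2 * u \<epsilon> - \<eta>)"
      using \<eta> by (simp add: pos_le_divide_eq)
    then have "2 * (j + 1) \<le> nat \<lfloor>R / (1/2 * u \<epsilon> - \<eta>)\<rfloor>"
      by (simp only: le_nat_floor)
    then have "l * (2 * (j + 1)) \<le> l * nat \<lfloor>R / (1/2 * u \<epsilon> - \<eta>)\<rfloor>"
      by (rule mult_le_mono2)
    \<comment> \<open>Here \<open>l \<ge> 1\<close> enters, as
      \<open>l + 1 \<le> 2 * l\<close>.\<close>
    moreover have "(j + 1) * Suc l \<le> l * (2 * (j + 1))"
      using mult_le_mono2[of "Suc l" "2 * l" "j + 1"] \<open>l \<ge> 1\<close> by (simp add: algebra_simps)
    ultimately show ?thesis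
      using k_less unfolding k_def by linarith
  qed simp
qed

theorem corollary22:
  fixes u :: "real \<Rightarrow> real"
    and x :: "'b::banach"
    and \<pi> :: "'g::{topological_group_add, t2_space, second_countable_topology} \<Rightarrow> 'b \<Rightarrow>\<^sub>L 'b"
    and M :: "'g measure"
    and F :: "nat \<Rightarrow> 'g set"
    and l :: nat
    and \<epsilon> \<eta> :: real
  assumes "uniform_convexity_modulus TYPE('b) u"
    and "\<epsilon> > 0" and "x \<noteq> 0"
    and "\<eta> > 0"
    and "norm x \<le> 1 \<Longrightarrow> \<eta> < 1/2 * u \<epsilon>"
    and "norm x > 1 \<Longrightarrow> \<eta> < 1/2 * u (\<epsilon> / norm x)"
    and "locally compact (UNIV :: 'g set)"
    and "amenable_group TYPE('g)"
    and "left_haar_measure M"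
    and "acts_borel_strongly \<pi>"
    and "folner_sequence M F"
    and "l \<ge> 1"
  shows "(norm x \<le> 1 \<and> fast_sequence M F l (\<eta> / (3 * norm x)) \<longrightarrow>
            at_most_fluctuations
              (l * nat \<lfloor>norm x / (1/2 * u \<epsilon> - \<eta>)\<rfloor> + l) \<epsilon>
              (ergodic_average M F \<pi> x)) \<and>
         (norm x > 1 \<and> fast_sequence M F l (\<eta> / 3) \<longrightarrow>
            at_most_fluctuations
              (l * nat \<lfloor>1 / (1/2 * u (\<epsilon> / norm x) - \<eta>)\<rfloor> + l) \<epsilon>
              (ergodic_average M F \<pi> x))"
proof (intro conjI impI; elim conjE)
  interpret folner_action M F \<pi>
    using assms by unfold_locales
  {
    assume "norm x \<le> 1" "fast_sequence M F l (\<eta> / (3 * norm x))"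
    \<comment> \<open>The bound \<open>R\<close> on the averages is \<open>norm x\<close>.\<close>
    then show "at_most_fluctuations (l * nat \<lfloor>norm x / (1/2 * u \<epsilon> - \<eta>)\<rfloor> + l) \<epsilon>
        (ergodic_average M F \<pi> x)"
      using assms
      by (intro at_most_fluctuations_midpoint_decrease norm_average_le norm_average_le_midpoint) auto
  next
    assume x: "norm x > 1" and fast: "fast_sequence M F l (\<eta> / 3)"
    \<comment> \<open>Case (b) is rescaled to the unit vector \<open>y\<close>: its speed
      \<open>\<eta> / (3 * norm y)\<close> is \<open>\<eta> / 3\<close>, its averages are bounded by
      \<open>R = 1\<close>, and \<epsilon> becomes \<open>\<epsilon> / norm x\<close>.\<close>
    define y where "y = (1 / norm x) *\<^sub>R x"
    have y: "norm y = 1" "x = norm x *\<^sub>R y"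
      using \<open>x \<noteq> 0\<close> by (simp_all add: y_def)
    have "at_most_fluctuations (l * nat \<lfloor>1 / (1/2 * u (\<epsilon> / norm x) - \<eta>)\<rfloor> + l) (\<epsilon> / norm x)
        (ergodic_average M F \<pi> y)"
    proof (rule at_most_fluctuations_midpoint_decrease)
      show "norm (average n y) \<le> 1" for n
        using norm_average_le[of y n] y by simp
      show "norm (average m y) \<le> norm ((1/2) *\<^sub>R (average k y + average n y)) + \<eta>"
        if "k + l \<le> m" "n + l \<le> m" for k n m
        using fast y that by (intro norm_average_le_midpoint) auto
    qed (use assms x in auto)
    then have "at_most_fluctuations (l * nat \<lfloor>1 / (1/2 * u (\<epsilon> / norm x) - \<eta>)\<rfloor> + l) \<epsilon>
        (\<lambda>n. norm x *\<^sub>R average n y)"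
      using x by (intro at_most_fluctuations_scaleR) auto
    also have "(\<lambda>n. norm x *\<^sub>R average n y) = ergodic_average M F \<pi> x"
      using y(2) average_scaleR[where c = "norm x" and x = y] by auto
    finally show "at_most_fluctuations (l * nat \<lfloor>1 / (1/2 * u (\<epsilon> / norm x) - \<eta>)\<rfloor> + l) \<epsilon>
        (ergodic_average M F \<pi> x)" .
  }
qed

end
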